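(* For every integer $k\geq 3$, $ex^*(n,P_k) \geq \frac{k}{2}n + O(1)$ as $n\to\infty$.
   Context: $P_k$ denotes the path with $k$ edges (and $k+1$ vertices). An edge coloring of a graph is proper if any two edges sharing a vertex receive different colors. A subgraph is rainbow if all its edges receive distinct colors. For a fixed graph $F$, the rainbow Turán number $ex^*(n,F)$ is the maximum number of edges in a properly edge-colored graph on $n$ vertices containing no rainbow copy of $F$. *)

theory Defs
  imports Complex_Main "HOL-Library.Landau_Symbols"
begin

type_synonym 'a graph = "'a set \<times> 'a set set"

definition simple_graph :: "'a graph \<Rightarrow> bool" where
  "simple_graph G \<longleftrightarrow> finite (fst G) \<and> snd G \<subseteq> {e. e \<subseteq> fst G \<and> card e = 2}"

definition subgraph_of :: "'a graph \<Rightarrow> 'a graph \<Rightarrow> bool" where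
  "subgraph_of H G \<longleftrightarrow> simple_graph H \<and> fst H \<subseteq> fst G \<and> snd H \<subseteq> snd G"

definition isomorphic_graphs :: "'a graph \<Rightarrow> 'b graph \<Rightarrow> bool" where
  "isomorphic_graphs F H \<longleftrightarrow>
     (\<exists>f. bij_betw f (fst F) (fst H) \<and> snd H = (\<lambda>e. f ` e) ` snd F)"

definition proper_edge_coloring :: "'a graph \<Rightarrow> ('a set \<Rightarrow> 'c) \<Rightarrow> bool" where
  "proper_edge_coloring G c \<longleftrightarrow>
     (\<forall>e \<in> snd G. \<forall>e' \<in> snd G. e \<noteq> e' \<and> e \<inter> e' \<noteq> {} \<longrightarrow> c e \<noteq> c e')"

definition rainbow :: "'a graph \<Rightarrow> ('a set \<Rightarrow> 'c) \<Rightarrow> bool" where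
  "rainbow H c \<longleftrightarrow> inj_on c (snd H)"

definition has_rainbow_copy :: "'a graph \<Rightarrow> ('a set \<Rightarrow> 'c) \<Rightarrow> 'b graph \<Rightarrow> bool" where
  "has_rainbow_copy G c F \<longleftrightarrow>
     (\<exists>H. subgraph_of H G \<and> isomorphic_graphs F H \<and> rainbow H c)"

(* Up to isomorphism an n-vertex graph has vertex set {..<n}; since it has finitely many
   edges, natural numbers suffice as colors.  The Max is over a finite set, which is nonempty
   whenever F has an edge (see below). *)
definition rainbow_turan_edge_counts :: "nat \<Rightarrow> 'b graph \<Rightarrow> nat set" where
  "rainbow_turan_edge_counts n F =
     {card (snd G) | G :: nat graph. simple_graph G \<and> fst G = {..<n} \<and>
        (\<exists>c :: nat set \<Rightarrow> nat. proper_edge_coloring G c \<and> \<not> has_rainbow_copy G c F)}"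

definition rainbow_turan :: "nat \<Rightarrow> 'b graph \<Rightarrow> nat" where
  "rainbow_turan n F = Max (rainbow_turan_edge_counts n F)"

definition path_graph :: "nat \<Rightarrow> nat graph" where
  "path_graph k = ({..k}, {{i, Suc i} | i. i < k})"

lemma finite_rainbow_turan_edge_counts: "finite (rainbow_turan_edge_counts n F)"
proof (rule finite_subset)
  show "rainbow_turan_edge_counts n F \<subseteq> card ` Pow (Pow {..<n})"
    by (force simp: rainbow_turan_edge_counts_def simple_graph_def)
qed auto

lemma rainbow_turan_edge_counts_nonempty:
  assumes "snd F \<noteq> {}"
  shows "rainbow_turan_edge_counts n F \<noteq> {}"
proof -
  let ?G = "({..<n}, {}) :: nat graph"
  have "\<not> has_rainbow_copy ?G (\<lambda>_. 0 :: nat) F"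
    using assms by (auto simp: has_rainbow_copy_def subgraph_of_def isomorphic_graphs_def)
  then have "card (snd ?G) \<in> rainbow_turan_edge_counts n F"
    unfolding rainbow_turan_edge_counts_def
    by (intro CollectI exI[of _ ?G] conjI exI[of _ "\<lambda>_. 0 :: nat"])
       (auto simp: simple_graph_def proper_edge_coloring_def)
  then show ?thesis by blast
qed

lemma simple_graph_path_graph: "simple_graph (path_graph k)"
  by (auto simp: simple_graph_def path_graph_def)

lemma card_edges_path_graph: "card (snd (path_graph k)) = k"
proof -
  have "snd (path_graph k) = (\<lambda>i. {i, Suc i}) ` {..<k}"
    by (auto simp: path_graph_def)
  moreover have "inj_on (\<lambda>i. {i, Suc i}) {..<k}"
    by (auto simp: inj_on_def doubleton_eq_iff)
  ultimately show ?thesis by (simp add: card_image)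
qed

end

theory Submission
  imports Defs
begin

text \<open>
  Take disjoint copies of the folded cube, the Cayley graph of \<open>(\<int>/2)\<^sup>k\<^sup>-\<^sup>1\<close> with respect to the
  \<open>k\<close> generators \<open>e\<^sub>1, \<dots>, e\<^sub>k\<^sub>-\<^sub>1\<close> and \<open>e\<^sub>1 + \<dots> + e\<^sub>k\<^sub>-\<^sub>1\<close>, and colour each edge by its generator.
  A rainbow walk with \<open>k\<close> edges uses every generator exactly once; as the generators add up
  to \<open>0\<close>, it is closed and hence not a path. The graph is \<open>k\<close>-regular, because the generators are
  distinct for \<open>k \<ge> 3\<close>, and only fewer than \<open>2\<^sup>k\<^sup>-\<^sup>1\<close> vertices are left isolated.
  The elements of \<open>(\<int>/2)\<^sup>k\<^sup>-\<^sup>1\<close> are the binary expansions of the numbers below \<open>2\<^sup>k\<^sup>-\<^sup>1\<close>;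
  the higher bits tell the copies apart.
\<close>

unbundle bit_operations_syntax

text \<open>\<open>Xor.F\<close> is the finite sum in the group of bit vectors. It serves twice:
  \<open>Xor.F id e\<close> is the colour of an edge \<open>e\<close>, and \<open>Xor.F id S\<close>
  is the sum of all generators.\<close>

interpretation Xor: comm_monoid_set "(XOR)" "0 :: nat"
  by unfold_locales simp_all

lemma xor_cancel_left: "a XOR (a XOR b) = b" for a b :: nat
  by (simp flip: xor.assoc)

lemma xor_eq_0_iff_nat: "a XOR b = 0 \<longleftrightarrow> a = b" for a b :: nat
  by (metis xor_cancel_left xor_self_eq xor.right_neutral)

lemma Xor_telescope: "Xor.F (\<lambda>i. f i XOR f (Suc i)) {..<n} = f 0 XOR f n" for f :: "nat \<Rightarrow> nat"
  by (induction n) (simp_all add: lessThan_Suc ac_simps xor_cancel_left)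

lemma Xor_exp: "Xor.F (\<lambda>i. 2 ^ i) {..<n} = mask n"
proof (induction n)
  case (Suc n)
  have "2 ^ n XOR mask n = (mask (Suc n) :: nat)"
    by (rule bit_eqI) (auto simp: bit_simps less_Suc_eq)
  with Suc show ?case by (simp add: lessThan_Suc)
qed simp

text \<open>Only the lowest \<open>m\<close> bits of \<open>v\<close> can change, so
  \<open>v\<close> stays in its block of \<open>2 ^ m\<close> consecutive numbers, which is one copy
  of the cube.\<close>

lemma xor_less_mult_exp:
  fixes v s q m :: nat
  assumes "s < 2 ^ m" "v < q * 2 ^ m"
  shows "v XOR s < q * 2 ^ m"
proof -
  have "(v XOR s) div 2 ^ m = v div 2 ^ m"
    using assms(1) drop_bit_xor[of m v s] by (simp add: drop_bit_eq_div)
  with assms(2) show ?thesis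
    by (metis less_mult_imp_div_less div_less_iff_less_mult zero_less_numeral zero_less_power)
qed

text \<open>Edges of a Cayley graph restricted to \<open>V\<close>. Every \<open>s\<close> is its
  own inverse, so undirected edges suffice.\<close>

definition xor_edges :: "nat set \<Rightarrow> nat set \<Rightarrow> nat set set" where
  "xor_edges V S = {{v, v XOR s} | v s. v \<in> V \<and> s \<in> S}"

lemma xor_edges_iff:
  assumes "\<And>v s. v \<in> V \<Longrightarrow> s \<in> S \<Longrightarrow> v XOR s \<in> V"
  shows "{u, v} \<in> xor_edges V S \<longleftrightarrow> u \<in> V \<and> v \<in> V \<and> u XOR v \<in> S"
proof
  assume "{u, v} \<in> xor_edges V S"
  then obtain w s where "{u, v} = {w, w XOR s}" "w \<in> V" "s \<in> S"
    by (auto simp: xor_edges_def)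
  then show "u \<in> V \<and> v \<in> V \<and> u XOR v \<in> S"
    using assms[of w s] by (auto simp: doubleton_eq_iff xor_cancel_left ac_simps)
next
  assume "u \<in> V \<and> v \<in> V \<and> u XOR v \<in> S"
  then show "{u, v} \<in> xor_edges V S"
    unfolding xor_edges_def
    by (intro CollectI exI[of _ u] exI[of _ "u XOR v"]) (simp add: xor_cancel_left)
qed

text \<open>The two ends are distinct, so both are summed and \<open>v\<close> cancels. Hence
  \<open>Xor.F id\<close> colours each edge by its generator.\<close>

lemma Xor_doubleton:
  assumes "s \<noteq> 0"
  shows "Xor.F id {v, v XOR s} = s"
proof -
  have "v \<noteq> v XOR s"
    using assms by (metis xor_cancel_left xor_self_eq)
  then show ?thesis by (simp add: xor_cancel_left)
qed

text \<open>XOR with \<open>s\<close> is a fixed-point-free involution on \<open>V\<close>; its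
  orbits are the edges, which form a perfect matching.\<close>

lemma card_xor_edges_singleton:
  assumes "finite V" "s \<noteq> 0" "\<And>v. v \<in> V \<Longrightarrow> v XOR s \<in> V"
  shows "2 * card (xor_edges V {s}) = card V"
proof -
  have U: "\<Union> (xor_edges V {s}) = V"
    using assms(3) by (auto simp: xor_edges_def)
  have "2 * card (xor_edges V {s}) = card (\<Union> (xor_edges V {s}))"
  proof (rule card_partition)
    show "finite (xor_edges V {s})"
      using assms(1) U by (metis finite_UnionD)
    show "card e = 2" if e: "e \<in> xor_edges V {s}" for e
    proof -
      obtain v where "e = {v, v XOR s}"
        using e by (auto simp: xor_edges_def)
      moreover have "v \<noteq> v XOR s"
        using assms(2) by (metis xor_cancel_left xor_self_eq)
      ultimately show ?thesis by simp
    qed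
    show "e \<inter> e' = {}" if "e \<in> xor_edges V {s}" "e' \<in> xor_edges V {s}" "e \<noteq> e'" for e e'
    proof (rule ccontr)
      assume "e \<inter> e' \<noteq> {}"
      moreover have "e = {w, w XOR s}" if "e \<in> xor_edges V {s}" "w \<in> e" for e w
        using that by (auto simp: xor_edges_def xor.assoc)
      ultimately show False using that by blast
    qed
  qed (use assms U in auto)
  with U show ?thesis by simp
qed

text \<open>The colour of an edge recovers its generator, so the edge set is a disjoint union of
  perfect matchings, one for each generator.\<close>

lemma card_xor_edges:
  assumes "finite V" "finite S" "0 \<notin> S" "\<And>v s. v \<in> V \<Longrightarrow> s \<in> S \<Longrightarrow> v XOR s \<in> V"
  shows "2 * card (xor_edges V S) = card S * card V"
proof -
  have color: "Xor.F id e = s" if e: "e \<in> xor_edges V {s}" and "s \<in> S" for e s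
  proof -
    obtain v where "e = {v, v XOR s}"
      using e by (auto simp: xor_edges_def)
    moreover have "s \<noteq> 0" using \<open>s \<in> S\<close> assms(3) by metis
    ultimately show ?thesis using Xor_doubleton by simp
  qed
  have "xor_edges V S = (\<Union>s\<in>S. xor_edges V {s})"
    by (auto simp: xor_edges_def)
  moreover have "card (\<Union>s\<in>S. xor_edges V {s}) = (\<Sum>s\<in>S. card (xor_edges V {s}))"
  proof (rule card_UN_disjoint)
    show "\<forall>s\<in>S. finite (xor_edges V {s})"
      using assms(1) by (auto simp: xor_edges_def)
    show "\<forall>s\<in>S. \<forall>t\<in>S. s \<noteq> t \<longrightarrow> xor_edges V {s} \<inter> xor_edges V {t} = {}"
      using color by blast
  qed (use assms in auto)
  moreover have "2 * card (xor_edges V {s}) = card V" if "s \<in> S" for s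
    using assms that by (intro card_xor_edges_singleton) metis+
  ultimately show ?thesis
    by (simp add: sum_distrib_left)
qed

lemma simple_graph_xor_edges:
  assumes "finite W" "V \<subseteq> W" "0 \<notin> S" "\<And>v s. v \<in> V \<Longrightarrow> s \<in> S \<Longrightarrow> v XOR s \<in> V"
  shows "simple_graph (W, xor_edges V S)"
proof -
  have "v \<noteq> v XOR s" if "s \<in> S" for v s
    using assms(3) that by (metis xor_cancel_left xor_self_eq)
  with assms show ?thesis
    by (fastforce simp: simple_graph_def xor_edges_def card_insert_if)
qed

lemma proper_edge_coloring_xor_edges:
  assumes "0 \<notin> S"
  shows "proper_edge_coloring (W, xor_edges V S) (Xor.F id)"
proof -
  \<comment> \<open>One end and the colour determine the other end, so two edges with a common end
    and the same colour coincide.\<close>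
  have edge: "e = {w, w XOR Xor.F id e}" if e: "e \<in> xor_edges V S" and "w \<in> e" for e w
  proof -
    obtain v s where "e = {v, v XOR s}" "s \<in> S"
      using e by (auto simp: xor_edges_def)
    moreover have "Xor.F id e = s"
      using calculation assms Xor_doubleton[of s v] by metis
    ultimately show ?thesis using \<open>w \<in> e\<close> by (auto simp: xor.assoc)
  qed
  show ?thesis
    unfolding proper_edge_coloring_def
  proof (intro ballI impI notI)
    fix e e'
    assume "e \<in> snd (W, xor_edges V S)" "e' \<in> snd (W, xor_edges V S)"
      "e \<noteq> e' \<and> e \<inter> e' \<noteq> {}" "Xor.F id e = Xor.F id e'"
    then show False using edge by (metis disjoint_iff snd_conv)
  qed
qed

lemma no_rainbow_path_xor_edges:
  assumes "0 \<notin> S" "finite S" "card S = k" "0 < k" "Xor.F id S = 0"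
    and closed: "\<And>v s. v \<in> V \<Longrightarrow> s \<in> S \<Longrightarrow> v XOR s \<in> V"
  shows "\<not> has_rainbow_copy (W, xor_edges V S) (Xor.F id) (path_graph k)"
proof
  assume "has_rainbow_copy (W, xor_edges V S) (Xor.F id) (path_graph k)"
  then obtain H f where H: "snd H \<subseteq> xor_edges V S" "inj_on (Xor.F id) (snd H)"
    and f: "bij_betw f {..k} (fst H)" "snd H = (`) f ` {{i, Suc i} |i. i < k}"
    by (auto simp: has_rainbow_copy_def subgraph_of_def isomorphic_graphs_def rainbow_def
        path_graph_def)
  have inj: "inj_on f {..k}"
    using f(1) by (rule bij_betw_imp_inj_on)
  have edge: "{f i, f (Suc i)} \<in> snd H" if "i < k" for i
    using that unfolding f(2) by (intro image_eqI[of _ _ "{i, Suc i}"]) auto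
  have color: "Xor.F id {f i, f (Suc i)} = f i XOR f (Suc i)" if "i < k" for i
  proof -
    have "f i \<noteq> f (Suc i)"
      using that inj by (auto dest: inj_onD)
    then show ?thesis by simp
  qed
  \<comment> \<open>Equal generators at two steps mean equal colours, hence the same edge by
    rainbowness, hence the same step because \<open>f\<close> is injective.\<close>
  have "inj_on (\<lambda>i. f i XOR f (Suc i)) {..<k}"
  proof (rule inj_onI)
    fix i j
    assume ij: "i \<in> {..<k}" "j \<in> {..<k}" "f i XOR f (Suc i) = f j XOR f (Suc j)"
    then have "{f i, f (Suc i)} = {f j, f (Suc j)}"
      using edge color H(2) by (metis inj_onD lessThan_iff)
    then have "f ` {i, Suc i} = f ` {j, Suc j}" by simp
    then have "{i, Suc i} = {j, Suc j}"
      using ij inj by (subst (asm) inj_on_image_eq_iff) auto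
    then show "i = j" by (auto simp: doubleton_eq_iff)
  qed
  moreover have "(\<lambda>i. f i XOR f (Suc i)) ` {..<k} \<subseteq> S"
    using edge H(1) xor_edges_iff[of V S, OF closed] by blast
  \<comment> \<open>The \<open>k\<close> steps use \<open>k\<close> distinct elements of
    \<open>S\<close>, which has only \<open>k\<close> elements.\<close>
  ultimately have "bij_betw (\<lambda>i. f i XOR f (Suc i)) {..<k} S"
    using assms(2,3) by (simp add: bij_betw_def card_image card_subset_eq)
  then have "Xor.F (\<lambda>i. f i XOR f (Suc i)) {..<k} = Xor.F id S"
    using Xor.reindex_bij_betw[of _ "{..<k}" S id] by simp
  then have "f 0 = f k"
    using assms(5) by (simp add: Xor_telescope xor_eq_0_iff_nat)
  then show False
    using inj assms(4) by (auto dest: inj_onD)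
qed

text \<open>\<open>mask m\<close> is the all-ones vector, the sum of the unit vectors
  \<open>2 ^ i\<close>.\<close>

definition folded_cube_generators :: "nat \<Rightarrow> nat set" where
  "folded_cube_generators m = insert (mask m) ((^) 2 ` {..<m})"

text \<open>Bits 0 and 1 are both set in \<open>mask m\<close>, but a power of two has a single bit.
  For \<open>m = 1\<close> the two generators would coincide, whence
  \<open>k \<ge> 3\<close>.\<close>

lemma mask_neq_exp:
  assumes "2 \<le> m"
  shows "mask m \<noteq> (2 ^ i :: nat)"
proof
  assume "mask m = (2 ^ i :: nat)"
  then have "bit (mask m :: nat) j \<longleftrightarrow> bit (2 ^ i :: nat) j" for j by simp
  from this[of 0] this[of 1] assms show False
    by (simp add: bit_simps)
qed

lemma folded_cube_generators:
  assumes "2 \<le> m"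
  shows finite_folded_cube_generators: "finite (folded_cube_generators m)"
    and card_folded_cube_generators: "card (folded_cube_generators m) = Suc m"
    and zero_notin_folded_cube_generators: "0 \<notin> folded_cube_generators m"
    and folded_cube_generators_less: "\<And>s. s \<in> folded_cube_generators m \<Longrightarrow> s < 2 ^ m"
    and Xor_folded_cube_generators: "Xor.F id (folded_cube_generators m) = 0"
proof -
  have inj: "inj_on ((^) (2 :: nat)) {..<m}"
    by (simp add: inj_on_def)
  have notin: "mask m \<notin> (^) (2 :: nat) ` {..<m}"
    using mask_neq_exp[OF assms] by blast
  show "finite (folded_cube_generators m)"
    by (simp add: folded_cube_generators_def)
  show "card (folded_cube_generators m) = Suc m"
    using inj notin by (simp add: folded_cube_generators_def card_image)
  show "0 \<notin> folded_cube_generators m"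
    using assms by (auto simp: folded_cube_generators_def)
  show "s < 2 ^ m" if "s \<in> folded_cube_generators m" for s
    using that by (auto simp: folded_cube_generators_def mask_eq_exp_minus_1)
  show "Xor.F id (folded_cube_generators m) = 0"
    using notin by (simp add: folded_cube_generators_def Xor.reindex[OF inj] Xor_exp)
qed

lemma rainbow_turan_ge:
  assumes "simple_graph G" "fst G = {..<n}" "proper_edge_coloring G (c :: nat set \<Rightarrow> nat)"
    "\<not> has_rainbow_copy G c F"
  shows "card (snd G) \<le> rainbow_turan n F"
  unfolding rainbow_turan_def
  using assms
  by (intro Max_ge finite_rainbow_turan_edge_counts)
    (unfold rainbow_turan_edge_counts_def, blast)

theorem theorem3p1:
  fixes k :: nat
  assumes "k \<ge> 3"
  shows "\<exists>g :: nat \<Rightarrow> real. g \<in> O(\<lambda>_. 1) \<and>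
    (\<forall>n. real (rainbow_turan n (path_graph k)) \<ge> real k / 2 * real n + g n)"
proof (intro exI conjI allI)
  define m where "m = k - 1"
  then have m: "2 \<le> m" "k = Suc m" using assms by auto
  let ?N = "2 ^ m :: nat" and ?S = "folded_cube_generators m"
  \<comment> \<open>At most \<open>?N\<close> vertices stay outside the copies, and each costs
    \<open>k / 2\<close> edges.\<close>
  let ?g = "\<lambda>_ :: nat. - (real k / 2 * real ?N)"
  note S = folded_cube_generators[OF m(1)]
  show "?g \<in> O(\<lambda>_. 1)" by simp
  fix n
  \<comment> \<open>As many complete blocks of \<open>2 ^ m\<close> numbers as fit below
    \<open>n\<close>.\<close>
  define V where "V = {..<n div ?N * ?N}"
  let ?G = "({..<n}, xor_edges V ?S)"
  have closed: "v XOR s \<in> V" if "v \<in> V" "s \<in> ?S" for v s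
    using that S(4) xor_less_mult_exp unfolding V_def by blast
  have "V \<subseteq> {..<n}"
    by (auto simp: V_def intro: less_le_trans[OF _ div_times_less_eq_dividend])
  then have "simple_graph ?G"
    using S(3) closed by (intro simple_graph_xor_edges) auto
  moreover have "\<not> has_rainbow_copy ?G (Xor.F id) (path_graph k)"
    using S closed m(2) by (intro no_rainbow_path_xor_edges) auto
  ultimately have turan: "card (xor_edges V ?S) \<le> rainbow_turan n (path_graph k)"
    using rainbow_turan_ge[of ?G n "Xor.F id"] proper_edge_coloring_xor_edges[OF S(3)] by simp
  have "2 * card (xor_edges V ?S) = k * (n div ?N * ?N)"
    using card_xor_edges[of V ?S] S closed m(2) by (simp add: V_def)
  then have edges: "2 * real (card (xor_edges V ?S)) = real k * real (n div ?N * ?N)"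
    by (metis of_nat_mult of_nat_numeral)
  have "n \<le> n div ?N * ?N + ?N"
    by (metis add_left_mono div_mult_mod_eq less_imp_le mod_less_divisor zero_less_numeral zero_less_power)
  then have "real n \<le> real (n div ?N * ?N) + real ?N"
    by (metis of_nat_add of_nat_le_iff)
  then have "real k * real n \<le> real k * real (n div ?N * ?N) + real k * real ?N"
    by (metis distrib_left mult_left_mono of_nat_0_le_iff)
  with edges turan show "real k / 2 * real n + ?g n \<le> real (rainbow_turan n (path_graph k))"
    by linarith
qed

end
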